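(* Suppose $u$ is a parallel refractor and the target $\Sigma$ is regular from $X^\star=(x^\star,u(x^\star))\in C_\Omega$. There exist positive constants $\delta$, $C_1$, $C_2$ depending on $X^\star$, and a structural constant $C$, such that $B_\delta(x^\star)\subset\Omega$ and the following holds. If $\bar x,\hat x\in B_\delta(x^\star)$, $\bar Y\in F_u(\bar x)$, $\hat Y\in F_u(\hat x)$ and $|\bar Y-\hat Y|\ge|\bar x-\hat x|$, then there exists $x_0$ on the segment from $\bar x$ to $\hat x$ such that, with $X_0^\star=(x_0,u(x_0))$, $$u(x)-\phi(x,Y,X_0^\star)\le C|\bar Y-\hat Y|\,|\bar x-\hat x|+C|Y(\lambda)-Y|\,|x-x_0|-C_1|\bar Y-\hat Y|^2|x-x_0|^2$$ for all $Y(\lambda)=Y_{X_0^\star}(\lambda)\in[\bar Y,\hat Y]_{X_0^\star}$ with $1/4\le\lambda\le3/4$, all $Y\in\Sigma$, and all $x\in\Omega\cap B_{C_2}(x_0)$.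
   Context: Fix an integer $n\ge1$, constants $0<\kappa<1$, $M_0>0$, $0<\delta_0<1$, and a bounded domain $\Omega\subset\mathbb{R}^n$. Points of $\mathbb{R}^{n+1}$ are written $X=(x,x_{n+1})$ with $x\in\mathbb{R}^n$ (likewise $Y=(y,y_{n+1})$, $Z=(z,z_{n+1})$, $X_0=(x_0,x_{0,n+1})$); $B_r(a)$ is the ball of radius $r$ centered at $a$. Set $C_\Omega=\Omega\times(0,M_0)$, $$c(X,Y)=|X-Y|+\kappa(x_{n+1}-y_{n+1}),$$ $$\phi(x,Y,X_0)=y_{n+1}-\frac{\kappa\,c(X_0,Y)}{1-\kappa^2}-\sqrt{\frac{c(X_0,Y)^2}{(1-\kappa^2)^2}-\frac{|x-y|^2}{1-\kappa^2}}\quad\text{for } |x-y|\le \frac{c(X_0,Y)}{\sqrt{1-\kappa^2}}.$$ $D_x\phi$ is the gradient in $x$. Let $\mathcal T$ be the set of $Y\in\mathbb{R}^{n+1}$ such that for every $X_0\in C_\Omega$: $x_{0,n+1}\le y_{n+1}-\frac{\kappa c(X_0,Y)}{1-\kappa^2}$ and $\Omega\subset B_{\delta_0c(X_0,Y)/\sqrt{1-\kappa^2}}(y)$. For $v\in\mathbb{R}^n$ let $$Q(v)=\frac{\sqrt{1+(1-\kappa^2)|v|^2}-\kappa}{1+|v|^2},\qquad \Lambda(v)=(-Q(v)v,\;Q(v)+\kappa),$$ a unit vector. Target: $\Sigma\subset\mathbb{R}^{n+1}$ is a domain contained in an $n$-dimensional surface, its convex hull is contained in $\mathcal T$, and for each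 $X\in C_\Omega$ every $Y\in\Sigma$ is represented parametrically from $X$ as $Y=X+s_X(\Lambda)\Lambda$, $|\Lambda|=1$, with $s_X$ a positive function of the direction, Lipschitz in $\Lambda$. For $\bar Y,\hat Y\in\Sigma$ and $Z\in C_\Omega$ put $\bar v=D_x\phi(z,\bar Y,Z)$, $\hat v=D_x\phi(z,\hat Y,Z)$, $v(\lambda)=(1-\lambda)\bar v+\lambda\hat v$, $Y_Z(\lambda)=Z+s_Z(\Lambda(v(\lambda)))\Lambda(v(\lambda))$, and $[\bar Y,\hat Y]_Z=\Sigma\cap\{Z+s\Lambda(v(\lambda)):s>0,\lambda\in[0,1]\}$. It is assumed that $[\bar Y,\hat Y]_Z$ is a curve, i.e. for every $\lambda\in[0,1]$ the ray from $Z$ in direction $\Lambda(v(\lambda))$ meets $\Sigma$, at the single point $Y_Z(\lambda)$. Regularity of the target: $\Sigma$ is regular from $X_0\in C_\Omega$ if there exist a neighborhood $U_{X_0}$ of $X_0$ and positive constants $c_1,c_2$, depending on $U_{X_0}$, such that for all $\bar Y,\hat Y\in\Sigma$, $Z\in U_{X_0}$, $1/4\le\lambda\le3/4$ and $x\in\Omega$ with $|x-z|\le c_2$, $$\phi(x,Y_Z(\lambda),Z)\ge\min\{\phi(x,\bar Y,Z),\phi(x,\hat Y,Z)\}+c_1|\bar Y-\hat Y|^2|x-z|^2.$$ Parallel refractor: a function $u:\Omega\to[0,M_0]$ such that for every $x_0\in\Omega$ the set $F_u(x_0)=\{Y\in\Sigma: u(x)\le\phi(x,Y,X_0)\ \text{for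 all }x\in\Omega\}$, $X_0=(x_0,u(x_0))$, is nonempty. A structural constant here depends only on the bounds for the derivatives of $\phi$, i.e. only on $n,\kappa,\delta_0,M_0,\Omega$. *)

theory Defs
  imports "HOL-Analysis.Analysis"
begin

text \<open>Points of \<open>\<real>\<^sup>n\<^sup>+\<^sup>1\<close> are pairs \<open>(x, x')\<close> in \<open>(real^'n) \<times> real\<close>; the library norm on the
  product is the Euclidean one.\<close>

definition cylinder :: "(real^'n) set \<Rightarrow> real \<Rightarrow> ((real^'n) \<times> real) set" where
  "cylinder \<Omega> M0 = \<Omega> \<times> {0<..<M0}"

definition cost :: "real \<Rightarrow> (real^'n) \<times> real \<Rightarrow> (real^'n) \<times> real \<Rightarrow> real" where
  "cost \<kappa> X Y = norm (X - Y) + \<kappa> * (snd X - snd Y)"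

text \<open>\<open>phi\<close> is only meaningful for \<open>norm (x - fst Y) \<le> cost \<kappa> X0 Y / sqrt (1 - \<kappa>\<^sup>2)\<close>; for the targets
  considered below this holds for all \<open>x \<in> \<Omega>\<close>.\<close>

definition phi :: "real \<Rightarrow> real^'n \<Rightarrow> (real^'n) \<times> real \<Rightarrow> (real^'n) \<times> real \<Rightarrow> real" where
  "phi \<kappa> x Y X0 =
     snd Y - \<kappa> * cost \<kappa> X0 Y / (1 - \<kappa>\<^sup>2)
       - sqrt ((cost \<kappa> X0 Y)\<^sup>2 / (1 - \<kappa>\<^sup>2)\<^sup>2 - (norm (x - fst Y))\<^sup>2 / (1 - \<kappa>\<^sup>2))"

definition gradient :: "('a::real_inner \<Rightarrow> real) \<Rightarrow> 'a \<Rightarrow> 'a" where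
  "gradient f x = (THE D. GDERIV f x :> D)"

definition admissible_region ::
  "real \<Rightarrow> real \<Rightarrow> real \<Rightarrow> (real^'n) set \<Rightarrow> ((real^'n) \<times> real) set" where
  "admissible_region \<kappa> M0 \<delta>0 \<Omega> =
     {Y. \<forall>X0 \<in> cylinder \<Omega> M0.
           snd X0 \<le> snd Y - \<kappa> * cost \<kappa> X0 Y / (1 - \<kappa>\<^sup>2) \<and>
           \<Omega> \<subseteq> ball (fst Y) (\<delta>0 * cost \<kappa> X0 Y / sqrt (1 - \<kappa>\<^sup>2))}"

definition Q :: "real \<Rightarrow> real^'n \<Rightarrow> real" where
  "Q \<kappa> v = (sqrt (1 + (1 - \<kappa>\<^sup>2) * (norm v)\<^sup>2) - \<kappa>) / (1 + (norm v)\<^sup>2)"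

definition Lam :: "real \<Rightarrow> real^'n \<Rightarrow> (real^'n) \<times> real" where
  "Lam \<kappa> v = (- (Q \<kappa> v *\<^sub>R v), Q \<kappa> v + \<kappa>)"

text \<open>An \<open>n\<close>-dimensional surface in \<open>\<real>\<^sup>n\<^sup>+\<^sup>1\<close>: a subset that is locally homeomorphic to \<open>\<real>\<^sup>n\<close> in its
  subspace topology. No smoothness is required.\<close>

definition hypersurface :: "((real^'n) \<times> real) set \<Rightarrow> bool" where
  "hypersurface M \<longleftrightarrow>
     (\<forall>p\<in>M. \<exists>V (W :: (real^'n) set).
        openin (top_of_set M) V \<and> p \<in> V \<and> open W \<and> V homeomorphic W)"

definition domain_in_hypersurface :: "((real^'n) \<times> real) set \<Rightarrow> bool" where
  "domain_in_hypersurface \<Sigma> \<longleftrightarrow>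
     \<Sigma> \<noteq> {} \<and> connected \<Sigma> \<and> (\<exists>M. hypersurface M \<and> openin (top_of_set M) \<Sigma>)"

definition directions :: "((real^'n) \<times> real) set \<Rightarrow> (real^'n) \<times> real \<Rightarrow> ((real^'n) \<times> real) set" where
  "directions \<Sigma> X = {L. norm L = 1 \<and> (\<exists>t>0. X + t *\<^sub>R L \<in> \<Sigma>)}"

text \<open>\<open>s X\<close> is only constrained on the directions in which \<open>\<Sigma>\<close> is seen from \<open>X\<close>, and its Lipschitz
  constant may depend on \<open>X\<close>.\<close>

definition polar_representation ::
  "((real^'n) \<times> real) set \<Rightarrow> ((real^'n) \<times> real \<Rightarrow> (real^'n) \<times> real \<Rightarrow> real)
     \<Rightarrow> (real^'n) \<times> real \<Rightarrow> bool" where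
  "polar_representation \<Sigma> s X \<longleftrightarrow>
     (\<forall>Y\<in>\<Sigma>. \<exists>L\<in>directions \<Sigma> X. Y = X + s X L *\<^sub>R L) \<and>
     (\<forall>L\<in>directions \<Sigma> X. s X L > 0) \<and>
     (\<exists>K. K-lipschitz_on (directions \<Sigma> X) (s X))"

text \<open>The direction \<open>\<Lambda>(v(\<lambda>))\<close>; the parameter \<open>\<lambda>\<close> is called \<open>t\<close>.\<close>

definition interp_dir ::
  "real \<Rightarrow> (real^'n) \<times> real \<Rightarrow> (real^'n) \<times> real \<Rightarrow> (real^'n) \<times> real \<Rightarrow> real \<Rightarrow> (real^'n) \<times> real" where
  "interp_dir \<kappa> Ya Yb Z t =
     Lam \<kappa> ((1 - t) *\<^sub>R gradient (\<lambda>x. phi \<kappa> x Ya Z) (fst Z)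
              + t *\<^sub>R gradient (\<lambda>x. phi \<kappa> x Yb Z) (fst Z))"

definition interp_pt ::
  "real \<Rightarrow> ((real^'n) \<times> real \<Rightarrow> (real^'n) \<times> real \<Rightarrow> real)
     \<Rightarrow> (real^'n) \<times> real \<Rightarrow> (real^'n) \<times> real \<Rightarrow> (real^'n) \<times> real \<Rightarrow> real \<Rightarrow> (real^'n) \<times> real" where
  "interp_pt \<kappa> s Ya Yb Z t =
     Z + s Z (interp_dir \<kappa> Ya Yb Z t) *\<^sub>R interp_dir \<kappa> Ya Yb Z t"

definition target_curve ::
  "real \<Rightarrow> ((real^'n) \<times> real) set
     \<Rightarrow> (real^'n) \<times> real \<Rightarrow> (real^'n) \<times> real \<Rightarrow> (real^'n) \<times> real \<Rightarrow> ((real^'n) \<times> real) set" where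
  "target_curve \<kappa> \<Sigma> Ya Yb Z =
     \<Sigma> \<inter> {Z + r *\<^sub>R interp_dir \<kappa> Ya Yb Z t | r t. r > 0 \<and> t \<in> {0..1}}"

definition target ::
  "real \<Rightarrow> real \<Rightarrow> real \<Rightarrow> (real^'n) set \<Rightarrow> ((real^'n) \<times> real) set
     \<Rightarrow> ((real^'n) \<times> real \<Rightarrow> (real^'n) \<times> real \<Rightarrow> real) \<Rightarrow> bool" where
  "target \<kappa> M0 \<delta>0 \<Omega> \<Sigma> s \<longleftrightarrow>
     domain_in_hypersurface \<Sigma> \<and>
     convex hull \<Sigma> \<subseteq> admissible_region \<kappa> M0 \<delta>0 \<Omega> \<and>
     (\<forall>X\<in>cylinder \<Omega> M0. polar_representation \<Sigma> s X) \<and>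
     (\<forall>Ya\<in>\<Sigma>. \<forall>Yb\<in>\<Sigma>. \<forall>Z\<in>cylinder \<Omega> M0. \<forall>t\<in>{0..1}.
        \<Sigma> \<inter> {Z + r *\<^sub>R interp_dir \<kappa> Ya Yb Z t | r. r > 0} = {interp_pt \<kappa> s Ya Yb Z t})"

text \<open>The neighbourhood is taken inside the (open) cylinder, as the interpolating points are only
  meaningful for \<open>Z\<close> there.\<close>

definition regular_from ::
  "real \<Rightarrow> real \<Rightarrow> (real^'n) set \<Rightarrow> ((real^'n) \<times> real) set
     \<Rightarrow> ((real^'n) \<times> real \<Rightarrow> (real^'n) \<times> real \<Rightarrow> real) \<Rightarrow> (real^'n) \<times> real \<Rightarrow> bool" where
  "regular_from \<kappa> M0 \<Omega> \<Sigma> s X0 \<longleftrightarrow>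
     (\<exists>U c1 c2. open U \<and> X0 \<in> U \<and> U \<subseteq> cylinder \<Omega> M0 \<and> c1 > 0 \<and> c2 > 0 \<and>
        (\<forall>Ya\<in>\<Sigma>. \<forall>Yb\<in>\<Sigma>. \<forall>Z\<in>U. \<forall>t\<in>{1/4..3/4}. \<forall>x\<in>\<Omega>. norm (x - fst Z) \<le> c2 \<longrightarrow>
           phi \<kappa> x (interp_pt \<kappa> s Ya Yb Z t) Z
             \<ge> min (phi \<kappa> x Ya Z) (phi \<kappa> x Yb Z)
                + c1 * (norm (Ya - Yb))\<^sup>2 * (norm (x - fst Z))\<^sup>2))"

definition refractor_map ::
  "real \<Rightarrow> (real^'n) set \<Rightarrow> ((real^'n) \<times> real) set \<Rightarrow> (real^'n \<Rightarrow> real)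
     \<Rightarrow> real^'n \<Rightarrow> ((real^'n) \<times> real) set" where
  "refractor_map \<kappa> \<Omega> \<Sigma> u x0 = {Y\<in>\<Sigma>. \<forall>x\<in>\<Omega>. u x \<le> phi \<kappa> x Y (x0, u x0)}"

definition parallel_refractor ::
  "real \<Rightarrow> real \<Rightarrow> (real^'n) set \<Rightarrow> ((real^'n) \<times> real) set \<Rightarrow> (real^'n \<Rightarrow> real) \<Rightarrow> bool" where
  "parallel_refractor \<kappa> M0 \<Omega> \<Sigma> u \<longleftrightarrow>
     (\<forall>x\<in>\<Omega>. 0 \<le> u x \<and> u x \<le> M0) \<and> (\<forall>x0\<in>\<Omega>. refractor_map \<kappa> \<Omega> \<Sigma> u x0 \<noteq> {})"

end

theory Submission imports Defs begin

text \<open>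
  Write \<open>k = 1 - \<kappa>\<^sup>2\<close> and \<open>R(w, c) = sqrt (c\<^sup>2 - k |w|\<^sup>2)\<close>, so that the graph of
  \<open>\<phi>(\<cdot>, Y, X) = snd Y - (\<kappa> c + R(\<cdot> - fst Y, c)) / k\<close> with \<open>c = cost \<kappa> X Y\<close> is the lower half of
  the ellipsoid \<open>{Z. cost \<kappa> Z Y = c}\<close> with focus \<open>Y\<close>. It passes through \<open>X\<close>, and it is the same
  graph for every base point \<open>X\<close> on it.

  Let \<open>Xa\<close>, \<open>Xb\<close> be the graph points of \<open>u\<close> over \<open>xa\<close>, \<open>xb\<close>. At \<open>xa\<close> the ellipsoid
  \<open>\<phi>(\<cdot>, Ya, Xa)\<close> touches \<open>u\<close> and so lies below \<open>\<phi>(\<cdot>, Yb, Xb)\<close>; at \<open>xb\<close> the order is reversed.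
  Hence the two meet over some \<open>x0\<close> of the segment, at a height \<open>h \<ge> u x0\<close>
  (\<open>obtain_crossing\<close>), and both are unchanged when \<open>(x0, h)\<close> becomes the base point. Therefore
  \<open>u \<le> min (\<phi>(\<cdot>, Ya, (x0, h))) (\<phi>(\<cdot>, Yb, (x0, h)))\<close>. Lowering the base point to
  \<open>Z = (x0, u x0)\<close> costs a multiple of the gap \<open>h - u x0\<close>; then regularity of the target at \<open>Z\<close>
  replaces the minimum by \<open>\<phi>(\<cdot>, Y(\<lambda>), Z)\<close> and yields the negative quadratic term. Since
  \<open>\<phi>(\<cdot>, Y(\<lambda>), Z)\<close> and \<open>\<phi>(\<cdot>, Y, Z)\<close> agree at \<open>x0\<close>, their difference at \<open>x\<close> is a mixed second
  difference, of size \<open>|Y(\<lambda>) - Y| |x - x0|\<close> (\<open>phi_mixed_difference\<close>).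

  The gap is where the hypothesis \<open>|xa - xb| \<le> |Ya - Yb|\<close> enters (\<open>crossing_gap\<close>). From below, \<open>u\<close>
  is semiconcave, as each of its points is touched from above by an ellipsoid of bounded
  curvature: \<open>u x0\<close> is at least the interpolation of \<open>u xa\<close> and \<open>u xb\<close> minus a multiple of
  \<open>|xa - xb|\<^sup>2 \<le> |Ya - Yb| |xa - xb|\<close>. From above, \<open>\<phi>(\<cdot>, Ya, (x0, h))\<close> is convex, equals \<open>u xa\<close> at
  \<open>xa\<close>, and at \<open>xb\<close> exceeds \<open>\<phi>(xb, Yb, (x0, h)) = u xb\<close> by at most the mixed second difference, so
  \<open>h\<close> is at most the same interpolation plus a multiple of \<open>|Ya - Yb| |xa - xb|\<close>.

  All bounds on \<open>\<phi>\<close> come from exact difference-quotient identities for \<open>R\<close>, which compare two points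
  directly, without integrating derivatives along segments. They are uniform over the possibly
  unbounded admissible region, because \<open>R\<close> is comparable to \<open>c\<close> there and \<open>c\<close> has a positive lower bound determined by \<open>\<Omega>\<close>, \<open>\<kappa>\<close> and \<open>\<delta>\<close>.
\<close>

section \<open>The Lorentz norm on a narrow cone\<close>

locale refraction_constants =
  fixes \<kappa> \<delta> :: real
  assumes kappa_pos: "0 < \<kappa>" and kappa_less: "\<kappa> < 1"
    and delta_pos: "0 < \<delta>" and delta_less: "\<delta> < 1"
begin

definition k :: real where "k = 1 - \<kappa>\<^sup>2"

definition \<sigma> :: real where "\<sigma> = sqrt (1 - \<delta>\<^sup>2)"

definition lorentz_norm :: "'a::real_inner \<Rightarrow> real \<Rightarrow> real" where
  "lorentz_norm w c = sqrt (c\<^sup>2 - k * (norm w)\<^sup>2)"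

text \<open>The cone is strictly inside the light cone, the opening being controlled by \<open>\<delta> < 1\<close>; this is
  the condition that the admissible region imposes on \<open>w = x - fst Y\<close>, \<open>c = cost \<kappa> X Y\<close>.\<close>
definition in_cone :: "'a::real_inner \<Rightarrow> real \<Rightarrow> bool" where
  "in_cone w c \<longleftrightarrow> 0 < c \<and> sqrt k * norm w \<le> \<delta> * c"

lemma k_pos: "0 < k" and k_less: "k < 1"
  using kappa_pos kappa_less by (auto simp: k_def abs_square_less_1)

lemma sigma_pos: "0 < \<sigma>" and sigma_sq: "\<sigma>\<^sup>2 = 1 - \<delta>\<^sup>2"
  using delta_pos delta_less by (auto simp: \<sigma>_def abs_square_less_1 abs_square_le_1)

lemma in_cone_sq:
  assumes "in_cone w c"
  shows "k * (norm w)\<^sup>2 \<le> \<delta>\<^sup>2 * c\<^sup>2"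
proof -
  have "(sqrt k * norm w)\<^sup>2 \<le> (\<delta> * c)\<^sup>2"
    using assms k_pos by (intro power_mono) (auto simp: in_cone_def)
  then show ?thesis
    using k_pos by (simp add: power_mult_distrib)
qed

lemma lorentz_norm_ge:
  assumes "in_cone w c"
  shows "\<sigma> * c \<le> lorentz_norm w c"
proof -
  have "(\<sigma> * c)\<^sup>2 \<le> c\<^sup>2 - k * (norm w)\<^sup>2"
    using in_cone_sq[OF assms] by (simp add: power_mult_distrib sigma_sq algebra_simps)
  then show ?thesis
    unfolding lorentz_norm_def by (rule real_le_rsqrt)
qed

lemma lorentz_norm_pos:
  assumes "in_cone w c"
  shows "0 < lorentz_norm w c"
proof -
  have "0 < \<sigma> * c" using assms sigma_pos by (simp add: in_cone_def)
  then show ?thesis using lorentz_norm_ge[OF assms] by linarith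
qed

lemma lorentz_norm_sq:
  assumes "in_cone w c"
  shows "(lorentz_norm w c)\<^sup>2 = c\<^sup>2 - k * (norm w)\<^sup>2"
  using lorentz_norm_pos[OF assms] unfolding lorentz_norm_def by simp

text \<open>Factor \<open>R\<^sup>2 - R'\<^sup>2\<close> and divide by \<open>R + R'\<close>: on the cone both \<open>c + c'\<close> and
  \<open>k (|w| + |w'|)\<close> are controlled by \<open>(R + R') / \<sigma>\<close>, whatever the size of \<open>c\<close>.\<close>
lemma lorentz_norm_Lipschitz:
  assumes "in_cone w c" "in_cone w' c'"
  shows "\<bar>lorentz_norm w c - lorentz_norm w' c'\<bar> \<le> (\<bar>c - c'\<bar> + norm (w - w')) / \<sigma>"
proof -
  define R R' where "R = lorentz_norm w c" and "R' = lorentz_norm w' c'"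
  have c: "0 < c" "0 < c'" using assms by (auto simp: in_cone_def)
  have RR: "\<sigma> * (c + c') \<le> R + R'"
    using lorentz_norm_ge[OF assms(1)] lorentz_norm_ge[OF assms(2)] by (simp add: R_def R'_def algebra_simps)
  have pos: "0 < R + R'"
    using lorentz_norm_pos[OF assms(1)] lorentz_norm_pos[OF assms(2)] by (simp add: R_def R'_def)
  have sk: "0 < sqrt k" "sqrt k \<le> 1" using k_pos k_less by auto
  have kw: "k * (norm w + norm w') \<le> c + c'"
  proof -
    have "sqrt k * (norm w + norm w') \<le> \<delta> * (c + c')"
      using assms by (auto simp: in_cone_def algebra_simps)
    also have "\<dots> \<le> c + c'" using delta_less c by (intro mult_left_le_one_le) (use delta_pos in auto)
    finally have "sqrt k * (norm w + norm w') \<le> c + c'" .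
    moreover have "k * (norm w + norm w') = sqrt k * (sqrt k * (norm w + norm w'))"
      using k_pos by (simp flip: mult.assoc)
    moreover have "sqrt k * (sqrt k * (norm w + norm w')) \<le> sqrt k * (norm w + norm w')"
      using sk by (intro mult_left_le_one_le) auto
    ultimately show ?thesis by linarith
  qed
  have nw: "\<bar>(norm w)\<^sup>2 - (norm w')\<^sup>2\<bar> \<le> norm (w - w') * (norm w + norm w')"
  proof -
    have "(norm w)\<^sup>2 - (norm w')\<^sup>2 = (norm w - norm w') * (norm w + norm w')"
      by (simp add: power2_eq_square algebra_simps)
    then have "\<bar>(norm w)\<^sup>2 - (norm w')\<^sup>2\<bar> = \<bar>norm w - norm w'\<bar> * (norm w + norm w')"
      by (simp add: abs_mult)
    also have "\<dots> \<le> norm (w - w') * (norm w + norm w')"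
      by (intro mult_right_mono norm_triangle_ineq3) auto
    finally show ?thesis .
  qed
  have "(R - R') * (R + R') = (c - c') * (c + c') - k * ((norm w)\<^sup>2 - (norm w')\<^sup>2)"
    using lorentz_norm_sq[OF assms(1)] lorentz_norm_sq[OF assms(2)]
    by (simp add: R_def R'_def power2_eq_square algebra_simps)
  then have "\<bar>R - R'\<bar> * (R + R') = \<bar>(c - c') * (c + c') - k * ((norm w)\<^sup>2 - (norm w')\<^sup>2)\<bar>"
    using pos by (metis abs_mult abs_of_pos)
  also have "\<dots> \<le> \<bar>(c - c') * (c + c')\<bar> + \<bar>k * ((norm w)\<^sup>2 - (norm w')\<^sup>2)\<bar>"
    by (rule abs_triangle_ineq4)
  also have "\<dots> = \<bar>c - c'\<bar> * (c + c') + k * \<bar>(norm w)\<^sup>2 - (norm w')\<^sup>2\<bar>"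
    using c k_pos by (simp add: abs_mult)
  also have "\<dots> \<le> \<bar>c - c'\<bar> * (c + c') + k * (norm (w - w') * (norm w + norm w'))"
    using nw k_pos by (intro add_left_mono mult_left_mono) auto
  also have "\<dots> = \<bar>c - c'\<bar> * (c + c') + norm (w - w') * (k * (norm w + norm w'))"
    by (simp add: algebra_simps)
  also have "\<dots> \<le> \<bar>c - c'\<bar> * (c + c') + norm (w - w') * (c + c')"
    using kw by (intro add_left_mono mult_left_mono) auto
  also have "\<dots> = (\<bar>c - c'\<bar> + norm (w - w')) / \<sigma> * (\<sigma> * (c + c'))"
    using sigma_pos by (simp add: field_simps)
  also have "\<dots> \<le> (\<bar>c - c'\<bar> + norm (w - w')) / \<sigma> * (R + R')"
    using RR sigma_pos by (intro mult_left_mono) auto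
  finally have "\<bar>R - R'\<bar> \<le> (\<bar>c - c'\<bar> + norm (w - w')) / \<sigma>"
    by (rule mult_right_le_imp_le[OF _ pos])
  then show ?thesis by (simp add: R_def R'_def)
qed

lemma norm_le_lorentz_norm:
  assumes "in_cone w c"
  shows "norm w \<le> lorentz_norm w c / (sqrt k * \<sigma>)"
proof -
  have sk: "0 < sqrt k" using k_pos by simp
  have "\<sigma> * (sqrt k * norm w) \<le> \<sigma> * (\<delta> * c)"
    using assms sigma_pos by (simp add: in_cone_def)
  also have "\<dots> \<le> \<sigma> * c"
    using assms sigma_pos delta_pos delta_less by (simp add: in_cone_def)
  also have "\<dots> \<le> lorentz_norm w c" by (rule lorentz_norm_ge[OF assms])
  finally show ?thesis
    using sk sigma_pos by (simp add: field_simps)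
qed

text \<open>The difference of squares \<open>R\<^sup>2 - R0\<^sup>2\<close> is the exact mean value formula for \<open>R\<close>, the quotient of
  the sums standing for the derivative at an intermediate point.\<close>
lemma lorentz_norm_chord:
  assumes "in_cone w c" "in_cone w0 c"
  shows "lorentz_norm w c - lorentz_norm w0 c = - k * ((w - w0) \<bullet> ((w + w0) /\<^sub>R (lorentz_norm w c + lorentz_norm w0 c)))"
proof -
  have pos: "0 < lorentz_norm w c + lorentz_norm w0 c"
    using lorentz_norm_pos[OF assms(1)] lorentz_norm_pos[OF assms(2)] by linarith
  have "(lorentz_norm w c - lorentz_norm w0 c) * (lorentz_norm w c + lorentz_norm w0 c) = - k * ((w - w0) \<bullet> (w + w0))"
    using lorentz_norm_sq[OF assms(1)] lorentz_norm_sq[OF assms(2)]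
    by (simp add: power2_norm_eq_inner inner_diff_left inner_add_right inner_commute algebra_simps
        flip: power2_eq_square)
  then have "lorentz_norm w c - lorentz_norm w0 c = - k * ((w - w0) \<bullet> (w + w0)) / (lorentz_norm w c + lorentz_norm w0 c)"
    using pos by (intro eq_divide_imp) auto
  then show ?thesis
    by (simp add: divide_inverse mult_ac del: inverse_eq_divide)
qed

text \<open>A Taylor formula with exact remainder: its sign gives concavity of \<open>R\<close>, its size the bound on
  the curvature.\<close>
lemma lorentz_norm_expansion:
  assumes "in_cone w c" "in_cone w0 c"
  shows "lorentz_norm w c = lorentz_norm w0 c - k * ((w - w0) \<bullet> (w0 /\<^sub>R lorentz_norm w0 c))
           - (k * (norm (w - w0))\<^sup>2 + (lorentz_norm w c - lorentz_norm w0 c)\<^sup>2) / (2 * lorentz_norm w0 c)"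
proof -
  define R R0 where "R = lorentz_norm w c" and "R0 = lorentz_norm w0 c"
  have pos: "0 < R0" using lorentz_norm_pos[OF assms(2)] by (simp add: R0_def)
  have "R\<^sup>2 - R0\<^sup>2 = - k * (2 * ((w - w0) \<bullet> w0) + (norm (w - w0))\<^sup>2)"
    using lorentz_norm_sq[OF assms(1)] lorentz_norm_sq[OF assms(2)] unfolding R_def R0_def
    by (simp add: power2_norm_eq_inner inner_diff_left inner_diff_right inner_commute algebra_simps)
  then have "2 * R0 * R = 2 * R0 * R0 - k * (2 * ((w - w0) \<bullet> w0)) - (k * (norm (w - w0))\<^sup>2 + (R - R0)\<^sup>2)"
    by (simp add: power2_eq_square algebra_simps)
  then have "R = (2 * R0 * R0 - k * (2 * ((w - w0) \<bullet> w0)) - (k * (norm (w - w0))\<^sup>2 + (R - R0)\<^sup>2)) / (2 * R0)"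
    using pos by (intro eq_divide_imp) (auto simp: mult_ac)
  also have "\<dots> = R0 - k * ((w - w0) \<bullet> w0) / R0 - (k * (norm (w - w0))\<^sup>2 + (R - R0)\<^sup>2) / (2 * R0)"
    using pos by (simp add: diff_divide_distrib)
  also have "\<dots> = R0 - k * ((w - w0) \<bullet> (w0 /\<^sub>R R0)) - (k * (norm (w - w0))\<^sup>2 + (R - R0)\<^sup>2) / (2 * R0)"
    by (simp add: field_simps)
  finally show ?thesis
    unfolding R_def R0_def .
qed

lemma norm_quotient_diff_le:
  fixes w w' :: "'a::real_normed_vector"
  assumes "0 < r" "0 < r'" "norm w' \<le> B * r'"
  shows "norm (w /\<^sub>R r - w' /\<^sub>R r') \<le> (norm (w - w') + B * \<bar>r - r'\<bar>) / r"
proof -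
  have "w /\<^sub>R r - w' /\<^sub>R r' = (w - w') /\<^sub>R r + ((r' - r) / (r * r')) *\<^sub>R w'"
    using assms(1,2) by (simp add: algebra_simps diff_divide_distrib divide_inverse)
  then have "norm (w /\<^sub>R r - w' /\<^sub>R r') \<le> norm ((w - w') /\<^sub>R r) + norm (((r' - r) / (r * r')) *\<^sub>R w')"
    by (metis norm_triangle_ineq)
  also have "\<dots> = norm (w - w') / r + \<bar>r - r'\<bar> / r * (norm w' / r')"
    using assms(1,2) by (simp add: abs_mult divide_inverse abs_minus_commute mult_ac)
  also have "\<dots> \<le> norm (w - w') / r + \<bar>r - r'\<bar> / r * B"
    using assms by (intro add_left_mono mult_left_mono) (auto simp: divide_le_eq)
  finally show ?thesis by (simp add: add_divide_distrib mult_ac)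
qed

text \<open>Both differences are taken along the same increment \<open>w - w0\<close>, so by the chord formula it is
  enough to compare the two quotients. These differ by \<open>O(d / m)\<close>, as numerator and
  denominator are Lipschitz and the denominator is at least \<open>2 \<sigma> m\<close>.\<close>
lemma lorentz_norm_mixed_difference:
  assumes "in_cone w c" "in_cone w0 c" "in_cone w' c'" "in_cone w0' c'"
    and eq: "w - w0 = w' - w0'" and m: "0 < m" "m \<le> c"
    and d: "\<bar>c - c'\<bar> \<le> 2 * d" "norm (w - w') \<le> d" "norm (w0 - w0') \<le> d"
  shows "\<bar>(lorentz_norm w c - lorentz_norm w0 c) - (lorentz_norm w' c' - lorentz_norm w0' c')\<bar>
           \<le> k * ((1 + 3 / (sqrt k * \<sigma>\<^sup>2)) / (\<sigma> * m)) * d * norm (w - w0)"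
proof -
  define r r' where "r = lorentz_norm w c + lorentz_norm w0 c" and "r' = lorentz_norm w' c' + lorentz_norm w0' c'"
  define B where "B = 1 / (sqrt k * \<sigma>)"
  have B: "0 \<le> B" using k_pos sigma_pos by (simp add: B_def)
  have d0: "0 \<le> d" using d(2) norm_ge_zero order_trans by blast
  have r: "0 < r" "0 < r'"
    using lorentz_norm_pos assms(1-4) unfolding r_def r'_def by (meson add_pos_pos)+
  have rm: "2 * (\<sigma> * m) \<le> r"
  proof -
    have "\<sigma> * m \<le> \<sigma> * c" using m sigma_pos by simp
    then show ?thesis using lorentz_norm_ge[OF assms(1)] lorentz_norm_ge[OF assms(2)] unfolding r_def by linarith
  qed
  have "norm (w' + w0') \<le> norm w' + norm w0'" by (rule norm_triangle_ineq)
  also have "\<dots> \<le> B * r'"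
    using norm_le_lorentz_norm[OF assms(3)] norm_le_lorentz_norm[OF assms(4)]
    by (simp add: B_def r'_def add_divide_distrib)
  finally have wB: "norm (w' + w0') \<le> B * r'" .
  have rr: "\<bar>r - r'\<bar> \<le> 6 * d / \<sigma>"
  proof -
    have "\<bar>lorentz_norm w c - lorentz_norm w' c'\<bar> \<le> (2 * d + d) / \<sigma>"
      using lorentz_norm_Lipschitz[OF assms(1,3)] d sigma_pos
      by (elim order_trans) (intro divide_right_mono add_mono, auto)
    moreover have "\<bar>lorentz_norm w0 c - lorentz_norm w0' c'\<bar> \<le> (2 * d + d) / \<sigma>"
      using lorentz_norm_Lipschitz[OF assms(2,4)] d sigma_pos
      by (elim order_trans) (intro divide_right_mono add_mono, auto)
    ultimately have "\<bar>r - r'\<bar> \<le> (2 * d + d) / \<sigma> + (2 * d + d) / \<sigma>"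
      unfolding r_def r'_def by linarith
    then show ?thesis by (simp add: field_simps)
  qed
  have ww: "norm ((w + w0) - (w' + w0')) \<le> 2 * d"
  proof -
    have "(w + w0) - (w' + w0') = (w - w') + (w0 - w0')" by simp
    then have "norm ((w + w0) - (w' + w0')) \<le> norm (w - w') + norm (w0 - w0')"
      by (simp only: norm_triangle_ineq)
    then show ?thesis using d by linarith
  qed
  have "norm ((w + w0) /\<^sub>R r - (w' + w0') /\<^sub>R r') \<le> (norm ((w + w0) - (w' + w0')) + B * \<bar>r - r'\<bar>) / r"
    by (rule norm_quotient_diff_le[OF r wB])
  also have "\<dots> \<le> (2 * d + B * (6 * d / \<sigma>)) / r"
    using ww rr B r by (intro divide_right_mono add_mono mult_left_mono) auto
  also have "\<dots> \<le> (2 * d + B * (6 * d / \<sigma>)) / (2 * (\<sigma> * m))"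
    using rm B d0 sigma_pos m r by (intro divide_left_mono) auto
  also have "\<dots> = (1 + 3 / (sqrt k * \<sigma>\<^sup>2)) / (\<sigma> * m) * d"
    using sigma_pos m k_pos by (simp add: B_def field_simps power2_eq_square)
  finally have q: "norm ((w + w0) /\<^sub>R r - (w' + w0') /\<^sub>R r') \<le> (1 + 3 / (sqrt k * \<sigma>\<^sup>2)) / (\<sigma> * m) * d" .
  have "(lorentz_norm w c - lorentz_norm w0 c) - (lorentz_norm w' c' - lorentz_norm w0' c')
      = - k * ((w - w0) \<bullet> ((w + w0) /\<^sub>R r - (w' + w0') /\<^sub>R r'))"
    unfolding lorentz_norm_chord[OF assms(1,2)] lorentz_norm_chord[OF assms(3,4)] r_def r'_def eq[symmetric]
    by (simp add: inner_diff_right algebra_simps)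
  then have "\<bar>(lorentz_norm w c - lorentz_norm w0 c) - (lorentz_norm w' c' - lorentz_norm w0' c')\<bar>
      = k * \<bar>(w - w0) \<bullet> ((w + w0) /\<^sub>R r - (w' + w0') /\<^sub>R r')\<bar>"
    using k_pos by (simp add: abs_mult)
  also have "\<dots> \<le> k * (norm (w - w0) * norm ((w + w0) /\<^sub>R r - (w' + w0') /\<^sub>R r'))"
    using k_pos by (intro mult_left_mono Cauchy_Schwarz_ineq2) auto
  also have "\<dots> \<le> k * (norm (w - w0) * ((1 + 3 / (sqrt k * \<sigma>\<^sup>2)) / (\<sigma> * m) * d))"
    using k_pos q by (intro mult_left_mono) auto
  finally show ?thesis by (simp add: mult_ac)
qed


section \<open>The lower half ellipsoid\<close>

lemma phi_eq:
  "phi \<kappa> x Y X0 = snd Y - (\<kappa> * cost \<kappa> X0 Y + lorentz_norm (x - fst Y) (cost \<kappa> X0 Y)) / k"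
proof -
  have "(cost \<kappa> X0 Y)\<^sup>2 / k\<^sup>2 - (norm (x - fst Y))\<^sup>2 / k = ((cost \<kappa> X0 Y)\<^sup>2 - k * (norm (x - fst Y))\<^sup>2) / k\<^sup>2"
    using k_pos by (simp add: field_simps power2_eq_square)
  then have "sqrt ((cost \<kappa> X0 Y)\<^sup>2 / k\<^sup>2 - (norm (x - fst Y))\<^sup>2 / k) = lorentz_norm (x - fst Y) (cost \<kappa> X0 Y) / k"
    using k_pos by (simp add: real_sqrt_divide lorentz_norm_def)
  then show ?thesis
    by (simp add: phi_def add_divide_distrib flip: k_def)
qed

text \<open>The cost depends on \<open>X - Y\<close> only, so one estimate serves for varying \<open>X\<close> and for varying
  \<open>Y\<close>.\<close>
lemma cost_Lipschitz:
  "\<bar>cost \<kappa> X Y - cost \<kappa> X' Y'\<bar> \<le> 2 * norm ((X - Y) - (X' - Y'))"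
proof -
  define V V' where "V = X - Y" and "V' = X' - Y'"
  have "\<bar>norm V - norm V'\<bar> \<le> norm (V - V')"
    by (rule norm_triangle_ineq3)
  moreover have "\<bar>\<kappa> * (snd V - snd V')\<bar> \<le> norm (V - V')"
  proof -
    have "\<bar>\<kappa> * (snd V - snd V')\<bar> \<le> 1 * \<bar>snd V - snd V'\<bar>"
      unfolding abs_mult using kappa_pos kappa_less by (intro mult_right_mono) auto
    also have "\<dots> \<le> norm (V - V')"
      using norm_snd_le[of "snd (V - V')" "fst (V - V')"] unfolding prod.collapse by simp
    finally show ?thesis .
  qed
  moreover have "cost \<kappa> X Y - cost \<kappa> X' Y' = (norm V - norm V') + \<kappa> * (snd V - snd V')"
    by (simp add: cost_def V_def V'_def algebra_simps)
  ultimately show ?thesis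
    unfolding V_def V'_def by linarith
qed

text \<open>Squaring \<open>|X0 - Y| = c + \<kappa> r\<close>, where \<open>r\<close> is the height of \<open>Y\<close> over \<open>X0\<close>, gives
  \<open>R\<^sup>2 = (k r - \<kappa> c)\<^sup>2\<close>; the hypothesis says that \<open>X0\<close> is on the lower half of the ellipsoid and
  so selects the root \<open>R = k r - \<kappa> c\<close>.\<close>
lemma phi_base_point:
  assumes "snd X0 \<le> snd Y - \<kappa> * cost \<kappa> X0 Y / k"
  shows "phi \<kappa> (fst X0) Y X0 = snd X0"
proof -
  define c r where "c = cost \<kappa> X0 Y" and "r = snd Y - snd X0"
  define d where "d = (norm (fst X0 - fst Y))\<^sup>2"
  have N: "(norm (X0 - Y))\<^sup>2 = d + r\<^sup>2"
    by (simp add: d_def r_def norm_prod_def power2_commute)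
  have "norm (X0 - Y) = c + \<kappa> * r"
    by (simp add: c_def r_def cost_def algebra_simps)
  then have E: "(c + \<kappa> * r)\<^sup>2 = d + r\<^sup>2" using N by simp
  have le: "\<kappa> * c \<le> k * r"
    using assms k_pos by (simp add: c_def r_def field_simps)
  have "(k * r - \<kappa> * c)\<^sup>2 - (c\<^sup>2 - k * d) = k * (d + r\<^sup>2 - (c + \<kappa> * r)\<^sup>2)"
    unfolding k_def by algebra
  then have "c\<^sup>2 - k * d = (k * r - \<kappa> * c)\<^sup>2" using E by simp
  then have "lorentz_norm (fst X0 - fst Y) c = k * r - \<kappa> * c"
    using le by (simp add: lorentz_norm_def d_def)
  then show ?thesis
    using k_pos by (simp add: phi_eq c_def[symmetric] r_def)
qed

text \<open>The same quadratic relation read backwards: a point of the graph is on the ellipsoid.\<close>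
lemma cost_on_ellipsoid:
  assumes "in_cone (x - fst Y) (cost \<kappa> X0 Y)"
  shows "cost \<kappa> (x, phi \<kappa> x Y X0) Y = cost \<kappa> X0 Y"
proof -
  define c r where "c = cost \<kappa> X0 Y" and "r = snd Y - phi \<kappa> x Y X0"
  define R d where "R = lorentz_norm (x - fst Y) c" and "d = (norm (x - fst Y))\<^sup>2"
  have R: "R\<^sup>2 = c\<^sup>2 - k * d" "0 < R"
    using lorentz_norm_sq lorentz_norm_pos assms by (auto simp: R_def c_def d_def)
  have r: "k * r = \<kappa> * c + R"
    using k_pos by (simp add: r_def phi_eq R_def c_def)
  have c: "0 < c" using assms by (simp add: in_cone_def c_def)
  have "0 < k * r" using r R c kappa_pos by (simp add: add_pos_pos)
  then have r0: "0 < r" using k_pos by (simp add: zero_less_mult_iff)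
  have "k * ((c + \<kappa> * r)\<^sup>2 - (d + r\<^sup>2)) = (c\<^sup>2 - k * d) - (k * r - \<kappa> * c)\<^sup>2"
    unfolding k_def by algebra
  also have "\<dots> = 0" using r R by simp
  finally have "(c + \<kappa> * r)\<^sup>2 = d + r\<^sup>2" using k_pos by simp
  then have "sqrt (d + r\<^sup>2) = c + \<kappa> * r"
    using c r0 kappa_pos by (metis add_nonneg_nonneg less_imp_le mult_nonneg_nonneg real_sqrt_unique)
  moreover have "norm ((x, phi \<kappa> x Y X0) - Y) = sqrt (d + r\<^sup>2)"
    by (simp add: norm_prod_def d_def r_def power2_commute)
  ultimately show ?thesis
    by (simp add: cost_def[of _ "(x, phi \<kappa> x Y X0)"] c_def r_def algebra_simps)
qed

lemma phi_recentre:
  assumes "in_cone (x0 - fst Y) (cost \<kappa> X0 Y)"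
  shows "phi \<kappa> x Y (x0, phi \<kappa> x0 Y X0) = phi \<kappa> x Y X0"
  by (simp add: phi_eq[of x] cost_on_ellipsoid[OF assms])

lemma phi_Lipschitz_space:
  assumes "in_cone (x - fst Y) (cost \<kappa> X0 Y)" "in_cone (x' - fst Y) (cost \<kappa> X0 Y)"
  shows "\<bar>phi \<kappa> x Y X0 - phi \<kappa> x' Y X0\<bar> \<le> 1 / (\<sigma> * k) * norm (x - x')"
proof -
  have "\<bar>lorentz_norm (x - fst Y) (cost \<kappa> X0 Y) - lorentz_norm (x' - fst Y) (cost \<kappa> X0 Y)\<bar> / k \<le> norm (x - x') / \<sigma> / k"
    using lorentz_norm_Lipschitz[OF assms] k_pos by (intro divide_right_mono) auto
  moreover have "phi \<kappa> x Y X0 - phi \<kappa> x' Y X0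
      = (lorentz_norm (x' - fst Y) (cost \<kappa> X0 Y) - lorentz_norm (x - fst Y) (cost \<kappa> X0 Y)) / k"
    by (simp add: phi_eq add_divide_distrib diff_divide_distrib)
  ultimately show ?thesis
    using k_pos by (simp add: abs_minus_commute)
qed

lemma phi_Lipschitz_base:
  assumes "in_cone (x - fst Y) (cost \<kappa> X0 Y)" "in_cone (x - fst Y) (cost \<kappa> X1 Y)"
  shows "\<bar>phi \<kappa> x Y X0 - phi \<kappa> x Y X1\<bar> \<le> 2 * (1 + 1 / \<sigma>) / k * norm (X0 - X1)"
proof -
  define c c' where "c = cost \<kappa> X0 Y" and "c' = cost \<kappa> X1 Y"
  define R R' where "R = lorentz_norm (x - fst Y) c" and "R' = lorentz_norm (x - fst Y) c'"
  have c: "\<bar>c - c'\<bar> \<le> 2 * norm (X0 - X1)"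
    using cost_Lipschitz[of X0 Y X1 Y] by (simp add: c_def c'_def)
  have R: "\<bar>R - R'\<bar> \<le> \<bar>c - c'\<bar> / \<sigma>"
    using lorentz_norm_Lipschitz[OF assms] by (simp add: R_def R'_def c_def c'_def)
  have "\<bar>phi \<kappa> x Y X0 - phi \<kappa> x Y X1\<bar> = \<bar>\<kappa> * (c - c') + (R - R')\<bar> / k"
  proof -
    have "phi \<kappa> x Y X0 - phi \<kappa> x Y X1 = - ((\<kappa> * (c - c') + (R - R')) / k)"
      by (simp add: phi_eq c_def c'_def R_def R'_def algebra_simps add_divide_distrib diff_divide_distrib)
    then show ?thesis using k_pos by simp
  qed
  also have "\<dots> \<le> (1 * \<bar>c - c'\<bar> + \<bar>c - c'\<bar> / \<sigma>) / k"
  proof -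
    have "\<bar>\<kappa> * (c - c')\<bar> \<le> 1 * \<bar>c - c'\<bar>"
      unfolding abs_mult using kappa_pos kappa_less by (intro mult_right_mono) auto
    then show ?thesis using R k_pos by (intro divide_right_mono) linarith+
  qed
  also have "\<dots> = (1 + 1 / \<sigma>) / k * \<bar>c - c'\<bar>"
    by (simp add: algebra_simps add_divide_distrib)
  also have "\<dots> \<le> (1 + 1 / \<sigma>) / k * (2 * norm (X0 - X1))"
    using c k_pos sigma_pos by (intro mult_left_mono) auto
  also have "\<dots> = 2 * (1 + 1 / \<sigma>) / k * norm (X0 - X1)" by simp
  finally show ?thesis .
qed

text \<open>A bound for the mixed difference quotients of \<open>\<phi>\<close> in \<open>x\<close> and \<open>Y\<close> where the cost is at least \<open>m\<close>.\<close>
definition mixed_const :: "real \<Rightarrow> real" where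
  "mixed_const m = (1 + 3 / (sqrt k * \<sigma>\<^sup>2)) / (\<sigma> * m)"

lemma phi_mixed_difference:
  assumes "in_cone (x - fst Y) (cost \<kappa> X0 Y)" "in_cone (x0 - fst Y) (cost \<kappa> X0 Y)"
    "in_cone (x - fst Y') (cost \<kappa> X0 Y')" "in_cone (x0 - fst Y') (cost \<kappa> X0 Y')"
    and m: "0 < m" "m \<le> cost \<kappa> X0 Y"
  shows "\<bar>(phi \<kappa> x Y X0 - phi \<kappa> x0 Y X0) - (phi \<kappa> x Y' X0 - phi \<kappa> x0 Y' X0)\<bar>
           \<le> mixed_const m * norm (Y - Y') * norm (x - x0)"
proof -
  let ?R = "\<lambda>x Y. lorentz_norm (x - fst Y) (cost \<kappa> X0 Y)"
  have "\<bar>(?R x Y - ?R x0 Y) - (?R x Y' - ?R x0 Y')\<bar>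
      \<le> k * ((1 + 3 / (sqrt k * \<sigma>\<^sup>2)) / (\<sigma> * m)) * norm (Y - Y') * norm ((x - fst Y) - (x0 - fst Y))"
    using cost_Lipschitz[of X0 Y X0 Y'] norm_fst_le[of "fst (Y - Y')" "snd (Y - Y')"]
    unfolding prod.collapse
    by (intro lorentz_norm_mixed_difference[OF assms(1-4)] m) (simp_all add: norm_minus_commute)
  then have "\<bar>(?R x Y - ?R x0 Y) - (?R x Y' - ?R x0 Y')\<bar> / k \<le> mixed_const m * norm (Y - Y') * norm (x - x0)"
    using k_pos by (simp add: mixed_const_def divide_le_eq mult_ac)
  moreover have "(phi \<kappa> x Y X0 - phi \<kappa> x0 Y X0) - (phi \<kappa> x Y' X0 - phi \<kappa> x0 Y' X0)
      = - (((?R x Y - ?R x0 Y) - (?R x Y' - ?R x0 Y')) / k)"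
    by (simp add: phi_eq add_divide_distrib diff_divide_distrib)
  ultimately show ?thesis
    using k_pos by simp
qed

text \<open>Half of a bound for \<open>D\<^sub>x\<^sup>2 \<phi>\<close> where the cost is at least \<open>m\<close>.\<close>
definition curvature_const :: "real \<Rightarrow> real" where
  "curvature_const m = (1 + 1 / (k * \<sigma>\<^sup>2)) / (2 * \<sigma> * m)"

text \<open>Convexity and semiconcavity of \<open>\<phi>\<close> in \<open>x\<close>, with the same vector \<open>p\<close> in both bounds: the gradient
  \<open>(x0 - y) / R0\<close>, which the expansion of \<open>R\<close> produces.\<close>
lemma phi_quadratic_bounds:
  fixes x0 :: "real^'n"
  assumes "in_cone (x0 - fst Y) (cost \<kappa> X0 Y)" and m: "0 < m" "m \<le> cost \<kappa> X0 Y"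
  obtains p where "\<And>x. in_cone (x - fst Y) (cost \<kappa> X0 Y) \<Longrightarrow>
      phi \<kappa> x0 Y X0 + (x - x0) \<bullet> p \<le> phi \<kappa> x Y X0 \<and>
      phi \<kappa> x Y X0 \<le> phi \<kappa> x0 Y X0 + (x - x0) \<bullet> p + curvature_const m * (norm (x - x0))\<^sup>2"
proof
  fix x assume x: "in_cone (x - fst Y) (cost \<kappa> X0 Y)"
  define R R0 where "R = lorentz_norm (x - fst Y) (cost \<kappa> X0 Y)" and "R0 = lorentz_norm (x0 - fst Y) (cost \<kappa> X0 Y)"
  define p where "p = (x0 - fst Y) /\<^sub>R R0"
  define N where "N = norm (x - x0)"
  define E where "E = (N\<^sup>2 + (R - R0)\<^sup>2 / k) / (2 * R0)"
  have sm: "\<sigma> * m \<le> R0"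
  proof -
    have "\<sigma> * m \<le> \<sigma> * cost \<kappa> X0 Y" using m sigma_pos by simp
    then show ?thesis using lorentz_norm_ge[OF assms(1)] by (simp add: R0_def)
  qed
  have sm0: "0 < \<sigma> * m" using m sigma_pos by simp
  have "R = R0 - k * ((x - x0) \<bullet> p) - (k * N\<^sup>2 + (R - R0)\<^sup>2) / (2 * R0)"
    using lorentz_norm_expansion[OF x assms(1)] by (simp add: R_def R0_def p_def N_def)
  moreover have "(k * N\<^sup>2 + (R - R0)\<^sup>2) / (2 * R0) = k * E"
    using k_pos sm sm0 by (simp add: E_def field_simps)
  ultimately have "R / k = R0 / k - (x - x0) \<bullet> p - E"
    using k_pos by (simp add: diff_divide_distrib)
  moreover have "phi \<kappa> x Y X0 - phi \<kappa> x0 Y X0 = R0 / k - R / k"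
    by (simp add: phi_eq R_def R0_def add_divide_distrib)
  ultimately have phi: "phi \<kappa> x Y X0 = phi \<kappa> x0 Y X0 + (x - x0) \<bullet> p + E"
    by simp
  have E0: "0 \<le> E" using sm sm0 k_pos by (simp add: E_def)
  have "\<bar>R - R0\<bar> \<le> N / \<sigma>"
    using lorentz_norm_Lipschitz[OF x assms(1)] by (simp add: R_def R0_def N_def)
  then have "(R - R0)\<^sup>2 \<le> (N / \<sigma>)\<^sup>2"
    using power_mono[of "\<bar>R - R0\<bar>" "N / \<sigma>" 2] by simp
  then have "(R - R0)\<^sup>2 / k \<le> (N / \<sigma>)\<^sup>2 / k"
    using k_pos by (intro divide_right_mono) auto
  then have "E \<le> (N\<^sup>2 + (N / \<sigma>)\<^sup>2 / k) / (2 * R0)"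
    using sm sm0 by (simp add: E_def divide_right_mono)
  also have "\<dots> \<le> (N\<^sup>2 + (N / \<sigma>)\<^sup>2 / k) / (2 * (\<sigma> * m))"
    using sm sm0 k_pos by (intro divide_left_mono) auto
  also have "\<dots> = curvature_const m * N\<^sup>2"
    using sm0 k_pos sigma_pos by (simp add: curvature_const_def field_simps power2_eq_square)
  finally show "phi \<kappa> x0 Y X0 + (x - x0) \<bullet> ((x0 - fst Y) /\<^sub>R lorentz_norm (x0 - fst Y) (cost \<kappa> X0 Y)) \<le> phi \<kappa> x Y X0 \<and>
      phi \<kappa> x Y X0 \<le> phi \<kappa> x0 Y X0 + (x - x0) \<bullet> ((x0 - fst Y) /\<^sub>R lorentz_norm (x0 - fst Y) (cost \<kappa> X0 Y))
        + curvature_const m * (norm (x - x0))\<^sup>2"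
    using phi E0 by (simp add: p_def N_def R0_def)
qed


text \<open>The ball that must contain \<open>\<Omega>\<close> has radius proportional to the cost, so the distance of any two
  points of \<open>\<Omega>\<close> bounds the cost below. The bound is the same for all targets.\<close>
lemma admissible_cost_bounded_below:
  fixes \<Omega> :: "(real^'n) set"
  assumes "open \<Omega>" "\<Omega> \<noteq> {}"
  obtains m where "0 < m"
    and "\<And>X Y. Y \<in> admissible_region \<kappa> M0 \<delta> \<Omega> \<Longrightarrow> X \<in> cylinder \<Omega> M0 \<Longrightarrow> m \<le> cost \<kappa> X Y"
proof -
  obtain a where a: "a \<in> \<Omega>" using assms by blast
  have "\<Omega> \<noteq> {a}" using assms(1) not_open_singleton by metis
  then obtain b where b: "b \<in> \<Omega>" "b \<noteq> a" using a by blast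
  have sk: "0 < sqrt k" using k_pos by simp
  show thesis
  proof
    show "0 < sqrt k * dist a b / (2 * \<delta>)"
      using b sk delta_pos by simp
    fix X Y :: "(real^'n) \<times> real"
    assume "Y \<in> admissible_region \<kappa> M0 \<delta> \<Omega>" "X \<in> cylinder \<Omega> M0"
    then have "\<Omega> \<subseteq> ball (fst Y) (\<delta> * cost \<kappa> X Y / sqrt k)"
      by (simp add: admissible_region_def k_def)
    then have "dist (fst Y) a < \<delta> * cost \<kappa> X Y / sqrt k" "dist (fst Y) b < \<delta> * cost \<kappa> X Y / sqrt k"
      using a b by auto
    then have "dist a b \<le> 2 * (\<delta> * cost \<kappa> X Y / sqrt k)"
      using dist_triangle3[of a b "fst Y"] by linarith
    then show "sqrt k * dist a b / (2 * \<delta>) \<le> cost \<kappa> X Y"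
      using sk delta_pos by (simp add: field_simps)
  qed
qed

end

section \<open>Regularity of parallel refractors\<close>

locale refractor = refraction_constants \<kappa> \<delta> for \<kappa> \<delta> :: real +
  fixes M0 m :: real and \<Omega> :: "(real^'n) set" and \<Sigma> :: "((real^'n) \<times> real) set" and u :: "real^'n \<Rightarrow> real"
  assumes M0_pos: "0 < M0" and m_pos: "0 < m"
    and Sigma_admissible: "\<Sigma> \<subseteq> admissible_region \<kappa> M0 \<delta> \<Omega>"
    and cost_bounded_below:
      "\<And>X Y. Y \<in> admissible_region \<kappa> M0 \<delta> \<Omega> \<Longrightarrow> X \<in> cylinder \<Omega> M0 \<Longrightarrow> m \<le> cost \<kappa> X Y"
    and is_refractor: "parallel_refractor \<kappa> M0 \<Omega> \<Sigma> u"
begin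

abbreviation F :: "real^'n \<Rightarrow> ((real^'n) \<times> real) set" where
  "F \<equiv> refractor_map \<kappa> \<Omega> \<Sigma> u"

text \<open>The graph of a refractor may touch the bottom or the top of the cylinder, whereas admissibility
  speaks of base points in the open cylinder. Non-strict inequalities pass to the limit.\<close>
lemma le_on_closed_cylinder:
  assumes X: "X \<in> \<Omega> \<times> {0..M0}" and f: "continuous_on UNIV f"
    and le: "\<And>X. X \<in> cylinder \<Omega> M0 \<Longrightarrow> f X \<le> (0::real)"
  shows "f X \<le> 0"
proof -
  have "X \<in> closure (cylinder \<Omega> M0)"
    using X M0_pos closure_subset[of \<Omega>] by (auto simp: cylinder_def closure_Times)
  then show ?thesis
    by (rule continuous_le_on_closure[OF continuous_on_subset[OF f subset_UNIV] _ le])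
qed

lemma continuous_on_cost: "continuous_on UNIV (\<lambda>X. cost \<kappa> X Y)"
  unfolding cost_def by (intro continuous_intros)

context
  fixes X Y
  assumes X: "X \<in> \<Omega> \<times> {0..M0}" and Y: "Y \<in> \<Sigma>"
begin

lemma m_le_cost: "m \<le> cost \<kappa> X Y"
proof -
  have Y': "Y \<in> admissible_region \<kappa> M0 \<delta> \<Omega>" using Y Sigma_admissible by blast
  have "m - cost \<kappa> X Y \<le> 0"
  proof (rule le_on_closed_cylinder[OF X])
    show "continuous_on UNIV (\<lambda>X. m - cost \<kappa> X Y)"
      by (intro continuous_on_diff continuous_on_const continuous_on_cost)
  qed (use cost_bounded_below[OF Y'] in simp)
  then show ?thesis by simp
qed

lemma in_cone_admissible:
  assumes "x \<in> \<Omega>"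
  shows "in_cone (x - fst Y) (cost \<kappa> X Y)"
proof -
  have "sqrt k * norm (x - fst Y) - \<delta> * cost \<kappa> X Y \<le> 0"
  proof (rule le_on_closed_cylinder[OF X])
    show "continuous_on UNIV (\<lambda>X. sqrt k * norm (x - fst Y) - \<delta> * cost \<kappa> X Y)"
      by (intro continuous_on_diff continuous_on_mult_left continuous_on_const continuous_on_cost)
    fix X assume "X \<in> cylinder \<Omega> M0"
    then have "\<Omega> \<subseteq> ball (fst Y) (\<delta> * cost \<kappa> X Y / sqrt k)"
      using Y Sigma_admissible by (auto simp: admissible_region_def k_def)
    then have "norm (x - fst Y) < \<delta> * cost \<kappa> X Y / sqrt k"
      using assms by (auto simp: dist_norm norm_minus_commute)
    then show "sqrt k * norm (x - fst Y) - \<delta> * cost \<kappa> X Y \<le> 0"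
      using k_pos by (simp add: field_simps)
  qed
  then show ?thesis
    using m_le_cost m_pos by (simp add: in_cone_def)
qed

lemma phi_at_base: "phi \<kappa> (fst X) Y X = snd X"
proof (rule phi_base_point)
  have "snd X - (snd Y - \<kappa> * cost \<kappa> X Y / k) \<le> 0"
  proof (rule le_on_closed_cylinder[OF X])
    show "continuous_on UNIV (\<lambda>X. snd X - (snd Y - \<kappa> * cost \<kappa> X Y / k))"
      using k_pos by (intro continuous_on_diff continuous_on_divide continuous_on_mult_left
          continuous_on_const continuous_on_snd continuous_on_id continuous_on_cost) auto
    show "snd X - (snd Y - \<kappa> * cost \<kappa> X Y / k) \<le> 0" if "X \<in> cylinder \<Omega> M0" for X
      using that Y Sigma_admissible by (force simp: admissible_region_def k_def)
  qed
  then show "snd X \<le> snd Y - \<kappa> * cost \<kappa> X Y / k" by simp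
qed

end

lemma graph_in_closed_cylinder: "x \<in> \<Omega> \<Longrightarrow> (x, u x) \<in> \<Omega> \<times> {0..M0}"
  using is_refractor by (auto simp: parallel_refractor_def)

lemma F_in_Sigma: "Y \<in> F x0 \<Longrightarrow> Y \<in> \<Sigma>"
  and F_above: "Y \<in> F x0 \<Longrightarrow> x \<in> \<Omega> \<Longrightarrow> u x \<le> phi \<kappa> x Y (x0, u x0)"
  by (auto simp: refractor_map_def)

lemma obtain_F:
  assumes "x0 \<in> \<Omega>"
  obtains Y where "Y \<in> F x0"
  using is_refractor assms unfolding parallel_refractor_def by blast

lemma F_touches: "x0 \<in> \<Omega> \<Longrightarrow> Y \<in> F x0 \<Longrightarrow> phi \<kappa> x0 Y (x0, u x0) = u x0"
  using phi_at_base[OF graph_in_closed_cylinder F_in_Sigma] by fastforce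

text \<open>Each value of \<open>u\<close> is touched from above by a function with the stated Lipschitz constant; exchange
  the two points for the other inequality.\<close>
lemma u_Lipschitz:
  assumes "x \<in> \<Omega>" "x' \<in> \<Omega>"
  shows "\<bar>u x - u x'\<bar> \<le> 1 / (\<sigma> * k) * norm (x - x')"
proof -
  have "u y - u y' \<le> 1 / (\<sigma> * k) * norm (y - y')" if y: "y \<in> \<Omega>" "y' \<in> \<Omega>" for y y'
  proof -
    obtain Y where Y: "Y \<in> F y'" using obtain_F y by blast
    note in_cone = in_cone_admissible[OF graph_in_closed_cylinder[OF y(2)] F_in_Sigma[OF Y]]
    show ?thesis
      using phi_Lipschitz_space[OF in_cone[OF y(1)] in_cone[OF y(2)]] F_above[OF Y y(1)] F_touches[OF y(2) Y]
      by linarith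
  qed
  from this[of x x'] this[of x' x] assms show ?thesis
    by (simp add: norm_minus_commute abs_le_iff)
qed

text \<open>The ellipsoid touching at \<open>x0\<close> bounds \<open>u xa\<close> and \<open>u xb\<close> from above; in the weighted sum the
  first-order terms cancel.\<close>
lemma u_semiconcave:
  assumes xa: "xa \<in> \<Omega>" and xb: "xb \<in> \<Omega>" and x0: "x0 \<in> \<Omega>"
    and t: "0 \<le> t" "t \<le> 1" and x0_eq: "x0 = (1 - t) *\<^sub>R xa + t *\<^sub>R xb"
  shows "(1 - t) * u xa + t * u xb \<le> u x0 + curvature_const m * (norm (xa - xb))\<^sup>2"
proof -
  obtain Y where Y: "Y \<in> F x0" using obtain_F x0 by blast
  note X0 = graph_in_closed_cylinder[OF x0]
  note Y\<Sigma> = F_in_Sigma[OF Y]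
  note in_cone = in_cone_admissible[OF X0 Y\<Sigma>]
  define K where "K = curvature_const m"
  have K: "0 \<le> K" using k_pos sigma_pos m_pos by (simp add: K_def curvature_const_def)
  obtain p where p: "\<And>x. in_cone (x - fst Y) (cost \<kappa> (x0, u x0) Y) \<Longrightarrow>
      phi \<kappa> x Y (x0, u x0) \<le> phi \<kappa> x0 Y (x0, u x0) + (x - x0) \<bullet> p + K * (norm (x - x0))\<^sup>2"
    using phi_quadratic_bounds[OF in_cone[OF x0] m_pos m_le_cost[OF X0 Y\<Sigma>]] unfolding K_def by metis
  have upper: "u x \<le> u x0 + (x - x0) \<bullet> p + K * (norm (xa - xb))\<^sup>2"
    if "x \<in> \<Omega>" "norm (x - x0) \<le> norm (xa - xb)" for x
  proof -
    have "K * (norm (x - x0))\<^sup>2 \<le> K * (norm (xa - xb))\<^sup>2"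
      using that K by (intro mult_left_mono power_mono) auto
    then show ?thesis
      using p[OF in_cone[OF that(1)]] F_above[OF Y that(1)] F_touches[OF x0 Y] by linarith
  qed
  have ea: "xa - x0 = t *\<^sub>R (xa - xb)" and eb: "xb - x0 = - ((1 - t) *\<^sub>R (xa - xb))"
    by (auto simp: x0_eq algebra_simps)
  have A: "u xa \<le> u x0 + t * ((xa - xb) \<bullet> p) + K * (norm (xa - xb))\<^sup>2"
    using upper[OF xa] t unfolding ea by (simp add: mult_left_le_one_le)
  have B: "u xb \<le> u x0 - (1 - t) * ((xa - xb) \<bullet> p) + K * (norm (xa - xb))\<^sup>2"
    using upper[OF xb] t unfolding eb by (simp add: mult_left_le_one_le)
  have "(1 - t) * u xa + t * u xb
      \<le> (1 - t) * (u x0 + t * ((xa - xb) \<bullet> p) + K * (norm (xa - xb))\<^sup>2)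
        + t * (u x0 - (1 - t) * ((xa - xb) \<bullet> p) + K * (norm (xa - xb))\<^sup>2)"
    using A B t by (intro add_mono mult_left_mono) auto
  also have "\<dots> = u x0 + K * (norm (xa - xb))\<^sup>2"
    by (simp add: algebra_simps)
  finally show ?thesis by (simp add: K_def)
qed

text \<open>The intermediate value theorem along the segment: the ellipsoid at \<open>xa\<close> touches \<open>u\<close> there and the
  other one is above \<open>u\<close>, and conversely at \<open>xb\<close>.\<close>
lemma obtain_crossing:
  assumes xa: "xa \<in> \<Omega>" and xb: "xb \<in> \<Omega>" and Ya: "Ya \<in> F xa" and Yb: "Yb \<in> F xb"
  obtains t where "0 \<le> t" "t \<le> 1"
    "phi \<kappa> ((1 - t) *\<^sub>R xa + t *\<^sub>R xb) Ya (xa, u xa) = phi \<kappa> ((1 - t) *\<^sub>R xa + t *\<^sub>R xb) Yb (xb, u xb)"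
proof -
  define f where "f = (\<lambda>t. phi \<kappa> ((1 - t) *\<^sub>R xa + t *\<^sub>R xb) Ya (xa, u xa)
    - phi \<kappa> ((1 - t) *\<^sub>R xa + t *\<^sub>R xb) Yb (xb, u xb))"
  have "continuous_on {0..1} f"
    unfolding f_def phi_eq lorentz_norm_def using k_pos by (intro continuous_intros) auto
  moreover have "f 0 \<le> 0" "0 \<le> f 1"
    using F_above[OF Yb xa] F_above[OF Ya xb] F_touches[OF xa Ya] F_touches[OF xb Yb]
    by (simp_all add: f_def)
  ultimately obtain t where "0 \<le> t" "t \<le> 1" "f t = 0"
    using IVT'[of f 0 0 1] by auto
  then show thesis using that by (simp add: f_def)
qed

section \<open>The estimate at a crossing point\<close>

context
  fixes xa xb x0 Ya Yb t h
  assumes xa: "xa \<in> \<Omega>" and xb: "xb \<in> \<Omega>" and x0: "x0 \<in> \<Omega>"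
    and Ya: "Ya \<in> F xa" and Yb: "Yb \<in> F xb"
    and t: "0 \<le> t" "t \<le> 1" and x0_eq: "x0 = (1 - t) *\<^sub>R xa + t *\<^sub>R xb"
    and ha: "phi \<kappa> x0 Ya (xa, u xa) = h" and hb: "phi \<kappa> x0 Yb (xb, u xb) = h"
    and h_le: "h \<le> M0"
    and separated: "norm (xa - xb) \<le> norm (Ya - Yb)"
begin

lemma u_le_crossing: "u x0 \<le> h"
  using F_above[OF Ya x0] ha by simp

lemma crossing_in_closed_cylinder: "(x0, h) \<in> \<Omega> \<times> {0..M0}"
  using graph_in_closed_cylinder[OF x0] u_le_crossing h_le by auto

text \<open>The crossing point is on both ellipsoids, so it may serve as base point for both.\<close>
lemma phi_from_crossing:
  "phi \<kappa> x Ya (x0, h) = phi \<kappa> x Ya (xa, u xa)" "phi \<kappa> x Yb (x0, h) = phi \<kappa> x Yb (xb, u xb)"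
  using phi_recentre[OF in_cone_admissible[OF graph_in_closed_cylinder[OF xa] F_in_Sigma[OF Ya] x0]]
    phi_recentre[OF in_cone_admissible[OF graph_in_closed_cylinder[OF xb] F_in_Sigma[OF Yb] x0]]
  by (simp_all add: ha hb)

text \<open>By convexity, \<open>h\<close> is at most the interpolation of the values at \<open>xa\<close> and \<open>xb\<close> of the ellipsoid with
  focus \<open>Ya\<close>. At \<open>xa\<close> this value is \<open>u xa\<close>. At \<open>xb\<close> it is compared with the ellipsoid with focus
  \<open>Yb\<close>, whose value there is \<open>u xb\<close>: both pass through \<open>(x0, h)\<close>, so the error is a mixed
  second difference. Semiconcavity bounds \<open>u x0\<close> below by the same interpolation.\<close>
lemma crossing_gap:
  "h - u x0 \<le> (mixed_const m + curvature_const m) * norm (Ya - Yb) * norm (xa - xb)"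
proof -
  let ?X = "(x0, h)"
  define D where "D = mixed_const m * norm (Ya - Yb) * norm (xa - xb)"
  note Xc = crossing_in_closed_cylinder
  note Ya\<Sigma> = F_in_Sigma[OF Ya] and Yb\<Sigma> = F_in_Sigma[OF Yb]
  note ca = in_cone_admissible[OF Xc Ya\<Sigma>] and cb = in_cone_admissible[OF Xc Yb\<Sigma>]
  note ma = m_le_cost[OF Xc Ya\<Sigma>]
  have M: "0 \<le> mixed_const m" and K: "0 \<le> curvature_const m"
    using k_pos sigma_pos m_pos by (simp_all add: mixed_const_def curvature_const_def)
  have at: "phi \<kappa> x0 Ya ?X = h" "phi \<kappa> x0 Yb ?X = h"
    "phi \<kappa> xa Ya ?X = u xa" "phi \<kappa> xb Yb ?X = u xb"
    using F_touches[OF xa Ya] F_touches[OF xb Yb] by (simp_all add: phi_from_crossing ha hb)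
  obtain p where p: "\<And>x. in_cone (x - fst Ya) (cost \<kappa> ?X Ya) \<Longrightarrow>
      phi \<kappa> x0 Ya ?X + (x - x0) \<bullet> p \<le> phi \<kappa> x Ya ?X"
    using phi_quadratic_bounds[OF ca[OF x0] m_pos ma] by metis
  have ea: "xa - x0 = t *\<^sub>R (xa - xb)" and eb: "xb - x0 = - ((1 - t) *\<^sub>R (xa - xb))"
    by (auto simp: x0_eq algebra_simps)
  have A: "h + t * ((xa - xb) \<bullet> p) \<le> u xa"
    using p[OF ca[OF xa]] unfolding ea by (simp add: at)
  have B: "h - (1 - t) * ((xa - xb) \<bullet> p) \<le> phi \<kappa> xb Ya ?X"
    using p[OF ca[OF xb]] unfolding eb by (simp add: at)
  have "mixed_const m * norm (Ya - Yb) * norm (xb - x0) \<le> D"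
    unfolding D_def eb using t M by (intro mult_left_mono) (auto simp: mult_left_le_one_le)
  then have "phi \<kappa> xb Ya ?X \<le> u xb + D"
    using phi_mixed_difference[OF ca[OF xb] ca[OF x0] cb[OF xb] cb[OF x0] m_pos ma] by (simp add: at)
  with B have B': "h - (1 - t) * ((xa - xb) \<bullet> p) \<le> u xb + D" by linarith
  have "h = (1 - t) * (h + t * ((xa - xb) \<bullet> p)) + t * (h - (1 - t) * ((xa - xb) \<bullet> p))"
    by (simp add: algebra_simps)
  also have "\<dots> \<le> (1 - t) * u xa + t * (u xb + D)"
    using A B' t by (intro add_mono mult_left_mono) auto
  also have "\<dots> \<le> (1 - t) * u xa + t * u xb + D"
    using t M by (simp add: D_def distrib_left mult_left_le_one_le)
  also have "\<dots> \<le> u x0 + curvature_const m * (norm (xa - xb))\<^sup>2 + D"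
    using u_semiconcave[OF xa xb x0 t x0_eq] by simp
  also have "curvature_const m * (norm (xa - xb))\<^sup>2 \<le> curvature_const m * (norm (Ya - Yb) * norm (xa - xb))"
    using separated K by (intro mult_left_mono) (auto simp: power2_eq_square intro: mult_right_mono)
  finally show ?thesis by (simp add: D_def algebra_simps)
qed

text \<open>Regularity of the target compares ellipsoids through the graph point over \<open>x0\<close>; the Lipschitz
  dependence on the base point carries the bound by the two ellipsoids from \<open>(x0, h)\<close> to it.\<close>
lemma u_le_min_phi:
  assumes x: "x \<in> \<Omega>"
  shows "u x \<le> min (phi \<kappa> x Ya (x0, u x0)) (phi \<kappa> x Yb (x0, u x0)) + 2 * (1 + 1 / \<sigma>) / k * (h - u x0)"
proof -
  have "u x \<le> phi \<kappa> x Y (x0, u x0) + 2 * (1 + 1 / \<sigma>) / k * (h - u x0)"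
    if Y: "Y \<in> \<Sigma>" and above: "u x \<le> phi \<kappa> x Y (x0, h)" for Y
  proof -
    have "norm ((x0, h) - (x0, u x0)) = h - u x0"
      using u_le_crossing by simp
    then show ?thesis
      using phi_Lipschitz_base[OF in_cone_admissible[OF crossing_in_closed_cylinder Y x]
          in_cone_admissible[OF graph_in_closed_cylinder[OF x0] Y x]] above by simp
  qed
  from this[OF F_in_Sigma[OF Ya]] this[OF F_in_Sigma[OF Yb]] F_above[OF Ya x] F_above[OF Yb x]
  show ?thesis by (simp add: phi_from_crossing)
qed

text \<open>Here \<open>Yt\<close> stands for a point \<open>Y(\<lambda>)\<close> of the interpolating curve and \<open>q\<close> for the quadratic gain of
  regularity.\<close>
lemma refractor_minus_phi_le:
  assumes x: "x \<in> \<Omega>" and Y: "Y \<in> \<Sigma>" and Yt: "Yt \<in> \<Sigma>"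
    and reg: "min (phi \<kappa> x Ya (x0, u x0)) (phi \<kappa> x Yb (x0, u x0)) + q \<le> phi \<kappa> x Yt (x0, u x0)"
  shows "u x - phi \<kappa> x Y (x0, u x0)
    \<le> 2 * (1 + 1 / \<sigma>) / k * (mixed_const m + curvature_const m) * norm (Ya - Yb) * norm (xa - xb)
      + mixed_const m * norm (Yt - Y) * norm (x - x0) - q"
proof -
  note X0 = graph_in_closed_cylinder[OF x0]
  note c = in_cone_admissible[OF X0 Y] and ct = in_cone_admissible[OF X0 Yt]
  have "2 * (1 + 1 / \<sigma>) / k * (h - u x0)
      \<le> 2 * (1 + 1 / \<sigma>) / k * ((mixed_const m + curvature_const m) * norm (Ya - Yb) * norm (xa - xb))"
    using crossing_gap k_pos sigma_pos by (intro mult_left_mono) auto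
  moreover have "phi \<kappa> x Yt (x0, u x0) - phi \<kappa> x Y (x0, u x0) \<le> mixed_const m * norm (Yt - Y) * norm (x - x0)"
    using phi_mixed_difference[OF ct[OF x] ct[OF x0] c[OF x] c[OF x0] m_pos m_le_cost[OF X0 Yt]]
      phi_at_base[OF X0 Y] phi_at_base[OF X0 Yt] by simp
  ultimately show ?thesis
    using u_le_min_phi[OF x] reg by (simp add: mult.assoc)
qed

end

end

theorem lemma5p2:
  fixes \<kappa> M0 \<delta>0 :: real and \<Omega> :: "(real^'n) set"
  assumes "0 < \<kappa>" "\<kappa> < 1" "0 < M0" "0 < \<delta>0" "\<delta>0 < 1"
    and "open \<Omega>" "connected \<Omega>" "\<Omega> \<noteq> {}" "bounded \<Omega>"
  shows "\<exists>C>0. \<forall>(\<Sigma> :: ((real^'n) \<times> real) set) s (Xs :: (real^'n) \<times> real).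
    target \<kappa> M0 \<delta>0 \<Omega> \<Sigma> s \<and> Xs \<in> cylinder \<Omega> M0 \<and> regular_from \<kappa> M0 \<Omega> \<Sigma> s Xs \<longrightarrow>
    (\<exists>\<delta>>0. \<exists>C1>0. \<exists>C2>0. ball (fst Xs) \<delta> \<subseteq> \<Omega> \<and>
      (\<forall>u. parallel_refractor \<kappa> M0 \<Omega> \<Sigma> u \<and> Xs = (fst Xs, u (fst Xs)) \<longrightarrow>
        (\<forall>xa \<in> ball (fst Xs) \<delta>. \<forall>xb \<in> ball (fst Xs) \<delta>.
         \<forall>Ya \<in> refractor_map \<kappa> \<Omega> \<Sigma> u xa. \<forall>Yb \<in> refractor_map \<kappa> \<Omega> \<Sigma> u xb.
          norm (Ya - Yb) \<ge> norm (xa - xb) \<longrightarrow>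
          (\<exists>x0 \<in> closed_segment xa xb.
            (\<forall>t \<in> {1/4..3/4}.
              interp_pt \<kappa> s Ya Yb (x0, u x0) t \<in> target_curve \<kappa> \<Sigma> Ya Yb (x0, u x0) \<and>
              (\<forall>Y\<in>\<Sigma>. \<forall>x \<in> \<Omega> \<inter> ball x0 C2.
                u x - phi \<kappa> x Y (x0, u x0)
                  \<le> C * norm (Ya - Yb) * norm (xa - xb)
                     + C * norm (interp_pt \<kappa> s Ya Yb (x0, u x0) t - Y) * norm (x - x0)
                     - C1 * (norm (Ya - Yb))\<^sup>2 * (norm (x - x0))\<^sup>2))))))"
proof -
  interpret refraction_constants \<kappa> \<delta>0
    using assms by unfold_locales
  obtain m where m: "0 < m" and cost_ge:
    "\<And>X Y. Y \<in> admissible_region \<kappa> M0 \<delta>0 \<Omega> \<Longrightarrow> X \<in> cylinder \<Omega> M0 \<Longrightarrow> m \<le> cost \<kappa> X Y"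
    using admissible_cost_bounded_below[OF \<open>open \<Omega>\<close> \<open>\<Omega> \<noteq> {}\<close>] by metis
  \<comment> \<open>\<open>A\<close> is the factor of the gap term, and \<open>C\<close> dominates both it and the mixed constant.\<close>
  define A where "A = 2 * (1 + 1 / \<sigma>) / k * (mixed_const m + curvature_const m)"
  define C where "C = A + mixed_const m"
  define L where "L = 1 / (\<sigma> * k)"
  have const_pos: "0 < mixed_const m" "0 < curvature_const m"
    using k_pos sigma_pos m by (auto simp: mixed_const_def curvature_const_def intro!: divide_pos_pos add_pos_pos)
  have A: "0 < A" using const_pos k_pos sigma_pos by (simp add: A_def add_pos_pos)
  have L: "0 < L" using k_pos sigma_pos by (simp add: L_def)
  have C: "0 < C" using A const_pos by (simp add: C_def)
  show ?thesis
  proof (rule exI[of _ C], intro conjI C allI impI, elim conjE)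
    fix \<Sigma> :: "((real^'n) \<times> real) set" and s and Xs :: "(real^'n) \<times> real"
    assume target: "target \<kappa> M0 \<delta>0 \<Omega> \<Sigma> s" and Xs: "Xs \<in> cylinder \<Omega> M0"
      and regular: "regular_from \<kappa> M0 \<Omega> \<Sigma> s Xs"
    have \<Sigma>: "\<Sigma> \<subseteq> admissible_region \<kappa> M0 \<delta>0 \<Omega>"
      using target hull_subset[of \<Sigma> convex] by (auto simp: target_def)
    have ray: "\<Sigma> \<inter> {Z + r *\<^sub>R interp_dir \<kappa> Ya Yb Z t | r. r > 0} = {interp_pt \<kappa> s Ya Yb Z t}"
      if "Ya \<in> \<Sigma>" "Yb \<in> \<Sigma>" "Z \<in> cylinder \<Omega> M0" "t \<in> {0..1}" for Ya Yb Z t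
      using target that unfolding target_def by blast
    obtain U c1 c2 where U: "open U" "Xs \<in> U" "U \<subseteq> cylinder \<Omega> M0" and c: "c1 > 0" "c2 > 0"
      and reg: "\<And>Ya Yb Z t x. Ya \<in> \<Sigma> \<Longrightarrow> Yb \<in> \<Sigma> \<Longrightarrow> Z \<in> U \<Longrightarrow> t \<in> {1/4..3/4} \<Longrightarrow> x \<in> \<Omega> \<Longrightarrow>
        norm (x - fst Z) \<le> c2 \<Longrightarrow>
        min (phi \<kappa> x Ya Z) (phi \<kappa> x Yb Z) + c1 * (norm (Ya - Yb))\<^sup>2 * (norm (x - fst Z))\<^sup>2
          \<le> phi \<kappa> x (interp_pt \<kappa> s Ya Yb Z t) Z"
      using regular unfolding regular_from_def by metis
    obtain \<rho> where \<rho>: "0 < \<rho>" "ball Xs \<rho> \<subseteq> U"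
      using U by (meson open_contains_ball)
    \<comment> \<open>Over the ball of radius \<open>\<delta>\<close> the graph stays within \<open>L * \<delta>\<close> of the height of \<open>Xs\<close>, and the
      crossing height within \<open>3 * L * \<delta>\<close>, as \<open>x0\<close> and \<open>xa\<close> are at most \<open>2 * \<delta>\<close> apart. So both points
      over \<open>x0\<close> are in \<open>U\<close>, and \<open>\<delta>\<close> is chosen before \<open>u\<close>.\<close>
    define \<delta> where "\<delta> = \<rho> / (1 + 3 * L)"
    have \<delta>: "0 < \<delta>" using \<rho> L by (simp add: \<delta>_def)
    have \<delta>\<rho>: "\<delta> + 3 * L * \<delta> = \<rho>"
    proof -
      have "\<delta> * (1 + 3 * L) = \<rho>" using L by (simp add: \<delta>_def)
      then show ?thesis by (simp add: algebra_simps)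
    qed
    have near: "(x, h) \<in> U" if "norm (x - fst Xs) < \<delta>" "\<bar>h - snd Xs\<bar> \<le> 3 * L * \<delta>" for x h
    proof -
      have "norm ((x, h) - Xs) \<le> norm (x - fst Xs) + norm (h - snd Xs)"
        using norm_Pair_le[of "x - fst Xs" "h - snd Xs"] by (simp add: minus_prod_def)
      then have "norm ((x, h) - Xs) < \<rho>" using that \<delta>\<rho> by simp
      then show ?thesis using \<rho>(2) by (auto simp: mem_ball dist_norm norm_minus_commute)
    qed
    have ball_\<Omega>: "ball (fst Xs) \<delta> \<subseteq> \<Omega>"
    proof
      fix x assume "x \<in> ball (fst Xs) \<delta>"
      then have "(x, snd Xs) \<in> U"
        using L \<delta> by (intro near) (auto simp: dist_norm norm_minus_commute)
      then show "x \<in> \<Omega>" using U(3) by (auto simp: cylinder_def)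
    qed
    have crossing_estimate: "\<exists>x0 \<in> closed_segment xa xb.
            (\<forall>t \<in> {1/4..3/4}.
              interp_pt \<kappa> s Ya Yb (x0, u x0) t \<in> target_curve \<kappa> \<Sigma> Ya Yb (x0, u x0) \<and>
              (\<forall>Y\<in>\<Sigma>. \<forall>x \<in> \<Omega> \<inter> ball x0 c2.
                u x - phi \<kappa> x Y (x0, u x0)
                  \<le> C * norm (Ya - Yb) * norm (xa - xb)
                     + C * norm (interp_pt \<kappa> s Ya Yb (x0, u x0) t - Y) * norm (x - x0)
                     - c1 * (norm (Ya - Yb))\<^sup>2 * (norm (x - x0))\<^sup>2))"
      if u: "parallel_refractor \<kappa> M0 \<Omega> \<Sigma> u" and Xs_u: "Xs = (fst Xs, u (fst Xs))"
        and xa: "xa \<in> ball (fst Xs) \<delta>" and xb: "xb \<in> ball (fst Xs) \<delta>"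
        and Ya: "Ya \<in> refractor_map \<kappa> \<Omega> \<Sigma> u xa" and Yb: "Yb \<in> refractor_map \<kappa> \<Omega> \<Sigma> u xb"
        and separated: "norm (xa - xb) \<le> norm (Ya - Yb)"
      for u xa xb Ya Yb
    proof -
      interpret refractor \<kappa> \<delta>0 M0 m \<Omega> \<Sigma> u
        using \<open>0 < M0\<close> m \<Sigma> cost_ge u by unfold_locales auto
      note Ya\<Sigma> = F_in_Sigma[OF Ya] and Yb\<Sigma> = F_in_Sigma[OF Yb]
      have in\<Omega>: "x \<in> \<Omega>" if "x \<in> ball (fst Xs) \<delta>" for x using ball_\<Omega> that by blast
      obtain \<tau> where \<tau>: "0 \<le> \<tau>" "\<tau> \<le> 1" and cross:
        "phi \<kappa> ((1 - \<tau>) *\<^sub>R xa + \<tau> *\<^sub>R xb) Ya (xa, u xa) = phi \<kappa> ((1 - \<tau>) *\<^sub>R xa + \<tau> *\<^sub>R xb) Yb (xb, u xb)"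
        using obtain_crossing[OF in\<Omega>[OF xa] in\<Omega>[OF xb] Ya Yb] by metis
      define x0 where "x0 = (1 - \<tau>) *\<^sub>R xa + \<tau> *\<^sub>R xb"
      define h where "h = phi \<kappa> x0 Ya (xa, u xa)"
      have h_eq: "phi \<kappa> x0 Ya (xa, u xa) = h" "phi \<kappa> x0 Yb (xb, u xb) = h"
        using cross by (simp_all add: h_def x0_def)
      have x0_seg: "x0 \<in> closed_segment xa xb"
        using \<tau> by (auto simp: x0_def closed_segment_def)
      have x0_ball: "x0 \<in> ball (fst Xs) \<delta>"
        using x0_seg xa xb closed_segment_subset[OF xa xb convex_ball] by blast
      have fstXs: "fst Xs \<in> \<Omega>" and sndXs: "snd Xs = u (fst Xs)"
        using Xs Xs_u by (auto simp: cylinder_def intro: snd_eqD)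
      have u_near: "\<bar>u x - snd Xs\<bar> \<le> L * \<delta>" if "x \<in> ball (fst Xs) \<delta>" for x
      proof -
        have "\<bar>u x - snd Xs\<bar> \<le> L * norm (x - fst Xs)"
          using u_Lipschitz[OF in\<Omega>[OF that] fstXs] by (simp add: sndXs L_def)
        also have "\<dots> \<le> L * \<delta>"
          using that L by (intro mult_left_mono) (auto simp: dist_norm norm_minus_commute)
        finally show ?thesis .
      qed
      have h_near: "\<bar>h - snd Xs\<bar> \<le> 3 * L * \<delta>"
      proof -
        note in_cone = in_cone_admissible[OF graph_in_closed_cylinder[OF in\<Omega>[OF xa]] Ya\<Sigma>]
        have "\<bar>h - u xa\<bar> \<le> L * norm (x0 - xa)"
          using phi_Lipschitz_space[OF in_cone[OF in\<Omega>[OF x0_ball]] in_cone[OF in\<Omega>[OF xa]]]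
            F_touches[OF in\<Omega>[OF xa] Ya] by (simp add: h_eq L_def)
        also have "norm (x0 - xa) \<le> 2 * \<delta>"
          using x0_ball xa dist_triangle3[of x0 xa "fst Xs"] by (simp add: dist_norm)
        finally have "\<bar>h - u xa\<bar> \<le> 2 * (L * \<delta>)" using L by simp
        then show ?thesis using u_near[OF xa] by linarith
      qed
      have "(x0, h) \<in> U"
        using x0_ball h_near by (intro near) (auto simp: dist_norm norm_minus_commute)
      then have h_le: "h \<le> M0" using U(3) by (auto simp: cylinder_def)
      have Z: "(x0, u x0) \<in> U"
      proof (rule near)
        show "norm (x0 - fst Xs) < \<delta>" using x0_ball by (simp add: dist_norm norm_minus_commute)
        have "0 \<le> L * \<delta>" using L \<delta> by simp
        then show "\<bar>u x0 - snd Xs\<bar> \<le> 3 * L * \<delta>" using u_near[OF x0_ball] by linarith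
      qed
      then have Zcyl: "(x0, u x0) \<in> cylinder \<Omega> M0" using U(3) by blast
      note estimate = refractor_minus_phi_le[OF in\<Omega>[OF xa] in\<Omega>[OF xb] in\<Omega>[OF x0_ball] Ya Yb \<tau> x0_def
          h_eq h_le separated]
      show ?thesis
      proof (intro bexI[OF _ x0_seg] ballI conjI)
        fix t :: real assume t: "t \<in> {1/4..3/4}"
        let ?Yt = "interp_pt \<kappa> s Ya Yb (x0, u x0) t"
        have t01: "t \<in> {0..1}" using t by auto
        have Yt: "?Yt \<in> \<Sigma> \<inter> {(x0, u x0) + r *\<^sub>R interp_dir \<kappa> Ya Yb (x0, u x0) t | r. r > 0}"
          unfolding ray[OF Ya\<Sigma> Yb\<Sigma> Zcyl t01] by simp
        then show "?Yt \<in> target_curve \<kappa> \<Sigma> Ya Yb (x0, u x0)"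
          using t01 unfolding target_curve_def by blast
        fix Y x assume Y: "Y \<in> \<Sigma>" and x: "x \<in> \<Omega> \<inter> ball x0 c2"
        have "min (phi \<kappa> x Ya (x0, u x0)) (phi \<kappa> x Yb (x0, u x0))
            + c1 * (norm (Ya - Yb))\<^sup>2 * (norm (x - x0))\<^sup>2 \<le> phi \<kappa> x ?Yt (x0, u x0)"
          using reg[OF Ya\<Sigma> Yb\<Sigma> Z t, of x] x by (simp add: dist_norm norm_minus_commute)
        then have "u x - phi \<kappa> x Y (x0, u x0)
            \<le> A * norm (Ya - Yb) * norm (xa - xb) + mixed_const m * norm (?Yt - Y) * norm (x - x0)
              - c1 * (norm (Ya - Yb))\<^sup>2 * (norm (x - x0))\<^sup>2"
          using estimate[of x Y ?Yt] x Y Yt unfolding A_def by blast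
        also have "A * norm (Ya - Yb) * norm (xa - xb) \<le> C * norm (Ya - Yb) * norm (xa - xb)"
          using const_pos by (intro mult_right_mono) (auto simp: C_def)
        also have "mixed_const m * norm (?Yt - Y) * norm (x - x0) \<le> C * norm (?Yt - Y) * norm (x - x0)"
          using A by (intro mult_right_mono) (auto simp: C_def)
        finally show "u x - phi \<kappa> x Y (x0, u x0)
            \<le> C * norm (Ya - Yb) * norm (xa - xb) + C * norm (?Yt - Y) * norm (x - x0)
              - c1 * (norm (Ya - Yb))\<^sup>2 * (norm (x - x0))\<^sup>2"
          by simp
      qed
    qed
    show "\<exists>\<delta>>0. \<exists>C1>0. \<exists>C2>0. ball (fst Xs) \<delta> \<subseteq> \<Omega> \<and>
      (\<forall>u. parallel_refractor \<kappa> M0 \<Omega> \<Sigma> u \<and> Xs = (fst Xs, u (fst Xs)) \<longrightarrow>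
        (\<forall>xa \<in> ball (fst Xs) \<delta>. \<forall>xb \<in> ball (fst Xs) \<delta>.
         \<forall>Ya \<in> refractor_map \<kappa> \<Omega> \<Sigma> u xa. \<forall>Yb \<in> refractor_map \<kappa> \<Omega> \<Sigma> u xb.
          norm (Ya - Yb) \<ge> norm (xa - xb) \<longrightarrow>
          (\<exists>x0 \<in> closed_segment xa xb.
            (\<forall>t \<in> {1/4..3/4}.
              interp_pt \<kappa> s Ya Yb (x0, u x0) t \<in> target_curve \<kappa> \<Sigma> Ya Yb (x0, u x0) \<and>
              (\<forall>Y\<in>\<Sigma>. \<forall>x \<in> \<Omega> \<inter> ball x0 C2.
                u x - phi \<kappa> x Y (x0, u x0)
                  \<le> C * norm (Ya - Yb) * norm (xa - xb)
                     + C * norm (interp_pt \<kappa> s Ya Yb (x0, u x0) t - Y) * norm (x - x0)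
                     - C1 * (norm (Ya - Yb))\<^sup>2 * (norm (x - x0))\<^sup>2)))))"
      by (rule exI[of _ \<delta>], rule conjI[OF \<delta>], rule exI[of _ c1], rule conjI[OF c(1)],
          rule exI[of _ c2], rule conjI[OF c(2)], rule conjI[OF ball_\<Omega>])
        (intro allI impI ballI, elim conjE, rule crossing_estimate)
  qed
qed

end
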